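(* Suppose $\mathcal{D}\subset\mathbb{R}^m$ is compact, $\mathbf{L}\in\mathbb{R}^{m\times m}$, and $\epsilon>0$. In the worst case over $f\in\mathcal{L}(\mathcal{D},\mathbf{L})$, the minimum number of samples needed to find the maximum of $f$ over $\mathcal{D}$ to within $\epsilon$ is the $\epsilon$-internal covering number: that is, the smallest $M$ for which there exist points $\mathbf{x}_1,\dots,\mathbf{x}_M\in\mathcal{D}$ such that $$\max_{j=1,\dots,M}f(\mathbf{x}_j)\ \ge\ \max_{\mathbf{x}\in\mathcal{D}}f(\mathbf{x})-\epsilon\qquad\text{for every } f\in\mathcal{L}(\mathcal{D},\mathbf{L})$$ equals $N_\epsilon(\mathcal{D};\mathbf{L})$.
   Context: For $\mathcal{D}\subset\mathbb{R}^m$ and $\mathbf{L}\in\mathbb{R}^{m\times m}$, $$\mathcal{L}(\mathcal{D},\mathbf{L})=\{f:\mathcal{D}\to\mathbb{R}\ :\ |f(\mathbf{x}_1)-f(\mathbf{x}_2)|\le\|\mathbf{L}(\mathbf{x}_1-\mathbf{x}_2)\|_2\ \text{ for all }\mathbf{x}_1,\mathbf{x}_2\in\mathcal{D}\}.$$ Let $\mathcal{B}_\epsilon(\mathbf{x}_j;\mathbf{L})=\{\mathbf{x}:\|\mathbf{L}(\mathbf{x}-\mathbf{x}_j)\|_2\le\epsilon\}$. The $\epsilon$-internal covering number $N_\epsilon(\mathcal{D};\mathbf{L})$ is the smallest $M$ for which there exist $\mathbf{x}_1,\dots,\mathbf{x}_M\in\mathcal{D}$ with $\mathcal{D}\subseteq\bigcup_{j=1}^M\mathcal{B}_\epsilon(\mathbf{x}_j;\mathbf{L})$.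 (It equals the internal covering number of the set $\mathbf{L}\mathcal{D}=\{\mathbf{L}\mathbf{x}:\mathbf{x}\in\mathcal{D}\}$ by Euclidean $\epsilon$-balls centered in $\mathbf{L}\mathcal{D}$.) *)

theory Defs
  imports "HOL-Analysis.Analysis"
begin

text \<open>Functions on \<open>D\<close> are represented by total functions; their values outside \<open>D\<close> are
  unconstrained and are never used.\<close>
definition lipschitz_class :: "(real^'m) set \<Rightarrow> real^'m^'m \<Rightarrow> (real^'m \<Rightarrow> real) set"
  where "lipschitz_class D L =
    {f. \<forall>x1\<in>D. \<forall>x2\<in>D. \<bar>f x1 - f x2\<bar> \<le> norm (L *v (x1 - x2))}"

definition lip_ball :: "real \<Rightarrow> real^'m \<Rightarrow> real^'m^'m \<Rightarrow> (real^'m) set"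
  where "lip_ball \<epsilon> c L = {x. norm (L *v (x - c)) \<le> \<epsilon>}"

definition internal_cover :: "real \<Rightarrow> (real^'m) set \<Rightarrow> real^'m^'m \<Rightarrow> nat \<Rightarrow> (nat \<Rightarrow> real^'m) \<Rightarrow> bool"
  where "internal_cover \<epsilon> D L M x \<longleftrightarrow>
    (\<forall>j\<in>{1..M}. x j \<in> D) \<and> D \<subseteq> (\<Union>j\<in>{1..M}. lip_ball \<epsilon> (x j) L)"

text \<open>The set of admissible \<open>M\<close> is nonempty for compact \<open>D\<close>; see \<open>internal_cover_exists\<close>.\<close>
definition internal_covering_number :: "real \<Rightarrow> (real^'m) set \<Rightarrow> real^'m^'m \<Rightarrow> nat"
  where "internal_covering_number \<epsilon> D L = (LEAST M. \<exists>x. internal_cover \<epsilon> D L M x)"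

text \<open>Both maxima are suprema in the extended reals, so that a maximum over the empty set
  is \<open>-\<infinity>\<close>: no samples (\<open>M = 0\<close>) suffice exactly when \<open>D\<close> is empty. The suprema over
  nonempty index sets are attained; see \<open>SUP_samples_eq_Max\<close> and \<open>SUP_lipschitz_class_attained\<close>.\<close>
definition samples_find_max ::
    "real \<Rightarrow> (real^'m) set \<Rightarrow> real^'m^'m \<Rightarrow> nat \<Rightarrow> (nat \<Rightarrow> real^'m) \<Rightarrow> bool"
  where "samples_find_max \<epsilon> D L M x \<longleftrightarrow>
    (\<forall>j\<in>{1..M}. x j \<in> D) \<and>
    (\<forall>f\<in>lipschitz_class D L.
      (SUP j\<in>{1..M}. ereal (f (x j))) \<ge> (SUP y\<in>D. ereal (f y)) - ereal \<epsilon>)"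

lemma SUP_samples_eq_Max:
  fixes f :: "real^'m \<Rightarrow> real" and M :: nat
  assumes "M \<ge> 1"
  shows "(SUP j\<in>{1..M}. ereal (f (x j))) = ereal (Max ((\<lambda>j. f (x j)) ` {1..M}))"
proof -
  let ?A = "(\<lambda>j. f (x j)) ` {1..M}"
  have A: "finite ?A" "?A \<noteq> {}" using assms by auto
  show ?thesis
  proof (rule antisym)
    show "(SUP j\<in>{1..M}. ereal (f (x j))) \<le> ereal (Max ?A)"
      by (rule SUP_least) (simp add: A)
    obtain j where "j \<in> {1..M}" "Max ?A = f (x j)" using Max_in[OF A] by blast
    then show "ereal (Max ?A) \<le> (SUP j\<in>{1..M}. ereal (f (x j)))"
      by (simp only:) (rule SUP_upper)
  qed
qed

lemma continuous_on_lipschitz_class: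
  fixes D :: "(real^'m) set"
  assumes "f \<in> lipschitz_class D L"
  shows "continuous_on D f"
  unfolding continuous_on_def
proof
  fix x assume x: "x \<in> D"
  have "((\<lambda>y. norm (L *v (y - x))) \<longlongrightarrow> norm (L *v (x - x))) (at x within D)"
    by (intro tendsto_intros bounded_linear.tendsto[OF matrix_vector_mul_bounded_linear])
  then have lim: "((\<lambda>y. norm (L *v (y - x))) \<longlongrightarrow> 0) (at x within D)" by simp
  have "\<forall>\<^sub>F y in at x within D. norm (f y - f x) \<le> norm (L *v (y - x))"
    using assms x by (auto simp: lipschitz_class_def eventually_at_filter)
  from Lim_null_comparison[OF this lim] show "(f \<longlongrightarrow> f x) (at x within D)"
    by (simp only: Lim_null[symmetric])
qed

lemma SUP_lipschitz_class_attained: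
  fixes D :: "(real^'m) set"
  assumes "compact D" "D \<noteq> {}" "f \<in> lipschitz_class D L"
  shows "\<exists>x\<in>D. (\<forall>y\<in>D. f y \<le> f x) \<and> (SUP y\<in>D. ereal (f y)) = ereal (f x)"
proof -
  obtain x where x: "x \<in> D" "\<forall>y\<in>D. f y \<le> f x"
    using continuous_attains_sup[OF assms(1,2) continuous_on_lipschitz_class[OF assms(3)]] by blast
  have "(SUP y\<in>D. ereal (f y)) = ereal (f x)"
  proof (rule antisym)
    show "(SUP y\<in>D. ereal (f y)) \<le> ereal (f x)"
      by (rule SUP_least) (simp add: x)
    show "ereal (f x) \<le> (SUP y\<in>D. ereal (f y))"
      by (rule SUP_upper) (rule x(1))
  qed
  with x show ?thesis by blast
qed

lemma internal_cover_exists: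
  fixes D :: "(real^'m) set"
  assumes "compact D" "\<epsilon> > 0"
  shows "\<exists>M x. internal_cover \<epsilon> D L M x"
proof -
  have "compact ((*v) L ` D)"
    by (rule compact_continuous_image[OF linear_continuous_on[OF matrix_vector_mul_bounded_linear]
          assms(1)])
  then have "seq_compact ((*v) L ` D)" by (simp only: seq_compact_eq_compact)
  from seq_compact_imp_totally_bounded[OF this, rule_format, OF assms(2)]
  obtain K where K: "finite K" "K \<subseteq> (*v) L ` D" "(*v) L ` D \<subseteq> (\<Union>c\<in>K. ball c \<epsilon>)"
    by (elim exE conjE)
  from finite_subset_image[OF K(1,2)] obtain C where C: "C \<subseteq> D" "finite C" "K = (*v) L ` C"
    by auto
  obtain x where x: "bij_betw x {1..card C} C"
    using ex_bij_betw_nat_finite_1[OF C(2)] by blast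
  have im: "x ` {1..card C} = C" using x by (simp add: bij_betw_def)
  have "D \<subseteq> (\<Union>c\<in>C. lip_ball \<epsilon> c L)"
  proof
    fix y assume "y \<in> D"
    with K(3) have "L *v y \<in> (\<Union>c\<in>K. ball c \<epsilon>)" by blast
    then obtain c where c: "c \<in> C" "dist (L *v c) (L *v y) < \<epsilon>" unfolding C(3) by auto
    then have "y \<in> lip_ball \<epsilon> c L"
      by (simp add: lip_ball_def dist_norm norm_minus_commute matrix_vector_mult_diff_distrib)
    with c(1) show "y \<in> (\<Union>c\<in>C. lip_ball \<epsilon> c L)" by blast
  qed
  also have "\<dots> = (\<Union>c\<in>x ` {1..card C}. lip_ball \<epsilon> c L)" by (simp only: im)
  also have "\<dots> = (\<Union>j\<in>{1..card C}. lip_ball \<epsilon> (x j) L)" by (rule image_image[THEN arg_cong])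
  finally have "D \<subseteq> (\<Union>j\<in>{1..card C}. lip_ball \<epsilon> (x j) L)" .
  moreover have "\<forall>j\<in>{1..card C}. x j \<in> D" using im C(1) by blast
  ultimately show ?thesis unfolding internal_cover_def by blast
qed

end

theory Submission
  imports Defs
begin

text \<open>Finite sets of sample points that locate every maximum to within \<open>\<epsilon>\<close> are exactly the
  internal \<open>\<epsilon>\<close>-covers, so the two least cardinalities agree because they are minima over the
  same set. If the points cover \<open>D\<close>, the Lipschitz bound compares the value at any point of \<open>D\<close>
  with the value at a sample that covers it. Conversely, for \<open>y \<in> D\<close> the cone
  \<open>z \<mapsto> - norm (L *v (z - y))\<close> lies in the class and peaks at \<open>y\<close> with value \<open>0\<close>; a sample
  with value at least \<open>-\<epsilon>\<close> is then a sample whose ball contains \<open>y\<close>. Compactness serves to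
  make the set of admissible sample sizes nonempty.\<close>

text \<open>This is the reverse triangle inequality for the seminorm \<open>norm (L *v _)\<close>.\<close>
lemma neg_cone_in_lipschitz_class:
  "(\<lambda>z. - norm (L *v (z - y))) \<in> lipschitz_class D L"
  unfolding lipschitz_class_def
proof (intro CollectI ballI)
  fix x1 x2
  have "L *v (x1 - x2) = L *v (x1 - y) - L *v (x2 - y)"
    by (simp add: matrix_vector_mult_diff_distrib)
  then show "\<bar>- norm (L *v (x1 - y)) - - norm (L *v (x2 - y))\<bar> \<le> norm (L *v (x1 - x2))"
    using norm_triangle_ineq3[of "L *v (x1 - y)" "L *v (x2 - y)"] by simp
qed

lemma internal_cover_imp_samples_find_max:
  assumes "internal_cover \<epsilon> D L M x"
  shows "samples_find_max \<epsilon> D L M x"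
  unfolding samples_find_max_def
proof (intro conjI ballI)
  show D: "x j \<in> D" if "j \<in> {1..M}" for j
    using assms that by (simp add: internal_cover_def)
  fix f assume f: "f \<in> lipschitz_class D L"
  have "ereal (f y) \<le> (SUP j\<in>{1..M}. ereal (f (x j))) + ereal \<epsilon>" if y: "y \<in> D" for y
  proof -
    obtain j where j: "j \<in> {1..M}" and ball: "norm (L *v (y - x j)) \<le> \<epsilon>"
      using assms y by (auto simp: internal_cover_def lip_ball_def)
    have "\<bar>f y - f (x j)\<bar> \<le> norm (L *v (y - x j))"
      using f y D[OF j] by (simp add: lipschitz_class_def)
    then have "ereal (f y) \<le> ereal (f (x j)) + ereal \<epsilon>"
      using ball by simp
    also have "\<dots> \<le> (SUP j\<in>{1..M}. ereal (f (x j))) + ereal \<epsilon>"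
      by (intro add_right_mono SUP_upper j)
    finally show ?thesis .
  qed
  then have "(SUP y\<in>D. ereal (f y)) \<le> (SUP j\<in>{1..M}. ereal (f (x j))) + ereal \<epsilon>"
    by (rule SUP_least)
  then show "(SUP y\<in>D. ereal (f y)) - ereal \<epsilon> \<le> (SUP j\<in>{1..M}. ereal (f (x j)))"
    by (simp add: ereal_minus_le)
qed

lemma samples_find_max_imp_internal_cover:
  assumes "samples_find_max \<epsilon> D L M x"
  shows "internal_cover \<epsilon> D L M x"
  unfolding internal_cover_def
proof (intro conjI subsetI)
  show "\<forall>j\<in>{1..M}. x j \<in> D"
    using assms by (simp add: samples_find_max_def)
  fix y assume y: "y \<in> D"
  define f where "f = (\<lambda>z. - norm (L *v (z - y)))"
  have "f \<in> lipschitz_class D L"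
    unfolding f_def by (rule neg_cone_in_lipschitz_class)
  then have good: "(SUP z\<in>D. ereal (f z)) - ereal \<epsilon> \<le> (SUP j\<in>{1..M}. ereal (f (x j)))"
    using assms by (simp add: samples_find_max_def)
  have "ereal (f y) \<le> (SUP z\<in>D. ereal (f z))"
    using y by (rule SUP_upper)
  then have "ereal (f y) - ereal \<epsilon> \<le> (SUP z\<in>D. ereal (f z)) - ereal \<epsilon>"
    by (intro ereal_minus_mono order_refl)
  with good have le: "ereal (f y) - ereal \<epsilon> \<le> (SUP j\<in>{1..M}. ereal (f (x j)))"
    by (rule order_trans[rotated])
  \<comment> \<open>Without samples the right-hand side would be \<open>-\<infinity>\<close>, while the left-hand side is finite.\<close>
  have M: "M \<ge> 1"
  proof (rule ccontr)
    assume "\<not> M \<ge> 1"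
    then show False using le by (simp add: bot_ereal_def)
  qed
  have "Max ((\<lambda>j. f (x j)) ` {1..M}) \<in> (\<lambda>j. f (x j)) ` {1..M}"
    using M by (intro Max_in) auto
  then obtain j where j: "j \<in> {1..M}" and max: "Max ((\<lambda>j. f (x j)) ` {1..M}) = f (x j)"
    by blast
  have "f y - \<epsilon> \<le> f (x j)"
    using le unfolding SUP_samples_eq_Max[OF M] max by simp
  then have "norm (L *v (x j - y)) \<le> \<epsilon>"
    by (simp add: f_def)
  moreover have "norm (L *v (x j - y)) = norm (L *v (y - x j))"
    by (simp add: matrix_vector_mult_diff_distrib norm_minus_commute)
  ultimately have "y \<in> lip_ball \<epsilon> (x j) L"
    by (simp add: lip_ball_def)
  with j show "y \<in> (\<Union>j\<in>{1..M}. lip_ball \<epsilon> (x j) L)" by blast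
qed

theorem theorem2p4:
  fixes D :: "(real^'m) set" and L :: "real^'m^'m" and \<epsilon> :: real
  assumes "compact D" and "\<epsilon> > 0"
  shows "(\<exists>M x. samples_find_max \<epsilon> D L M x) \<and>
    (LEAST M. \<exists>x. samples_find_max \<epsilon> D L M x) = internal_covering_number \<epsilon> D L"
proof -
  have "samples_find_max \<epsilon> D L M x \<longleftrightarrow> internal_cover \<epsilon> D L M x" for M x
    using internal_cover_imp_samples_find_max samples_find_max_imp_internal_cover by blast
  then show ?thesis
    using internal_cover_exists[OF assms] by (simp add: internal_covering_number_def)
qed

end
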